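(* Let $\Psi_h^0=0$ and $F^m=0$ on $\omega_{h,\infty}\setminus\omega_h$ for any $m\geq 1$ and let $\Psi_h^0|_{j=J-1}=0$. Let $(\breve\Psi^m,\widetilde\Psi^m,\Psi^m)$ be the solution, such that $\Psi^m\in H_h$ for any $m\ge0$, of the splitting scheme on the infinite mesh: for any $m\ge1$, $$ i\hbar\,\frac{\breve{\Psi}^m-\Psi^{m-1}}{\tau/2}=(V-\tilde V)\frac{\breve{\Psi}^m+\Psi^{m-1}}{2},\qquad i\hbar\,\frac{\Psi^m-\widetilde{\Psi}^m}{\tau/2}=(V-\tilde V)\frac{\Psi^m+\widetilde{\Psi}^m}{2}\quad\text{on }\omega_{h,\infty},$$ $$ i\hbar s_N\frac{\widetilde{\Psi}^m-\breve{\Psi}^m}{\tau}=-c_{\hbar}\Delta_{hN}\frac{\widetilde{\Psi}^m+\breve{\Psi}^m}{2}+s_N\Bigl(\tilde V\frac{\widetilde{\Psi}^m+\breve{\Psi}^m}{2}\Bigr)+F^m\quad\text{on }\omega_{h,\infty},$$ with $\breve\Psi^m=\widetilde\Psi^m=\Psi^m=0$ on $\Gamma_{h,\infty}$ for $m\ge1$ and $\Psi^0=\Psi^0_h$ on $\overline\omega_{h,\infty}$. Then this solution satisfies the following three-step splitting scheme on the finite space mesh $\overline\omega_h$, for any $m\ge1$: $$ i\hbar\,\frac{\breve{\Psi}^m-\Psi^{m-1}}{\tau/2}=(V-\tilde V)\frac{\breve{\Psi}^m+\Psi^{m-1}}{2},\qquad i\hbar\,\frac{\Psi^m-\widetilde{\Psi}^m}{\tau/2}=(V-\tilde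 V)\frac{\Psi^m+\widetilde{\Psi}^m}{2}\quad\text{on }\omega_h\cup\Gamma_{1h},$$ $$ i\hbar s_N\frac{\widetilde{\Psi}^m-\breve{\Psi}^m}{\tau}=-c_{\hbar}\Delta_{hN}\frac{\widetilde{\Psi}^m+\breve{\Psi}^m}{2}+s_N\Bigl(\tilde V\frac{\widetilde{\Psi}^m+\breve{\Psi}^m}{2}\Bigr)+F^m\quad\text{on }\omega_h,$$ with the boundary and initial conditions $\breve\Psi^m|_{\Gamma_h}=0$, $\widetilde\Psi^m|_{\Gamma_h}=0$, $\Psi^m|_{\Gamma_h}=0$, $\Psi^0=\Psi^0_h$ on $\overline\omega_h$, as well as the discrete transparent boundary condition for the Fourier coefficients of the solution $$ \Bigl[c_{\hbar,q}\bar\partial_x\frac{\widetilde\Psi^{m(q)}+\breve\Psi^{m(q)}}{2}-h_xs^-_{\theta_qx}\Bigl(i\hbar\frac{\widetilde\Psi^{m(q)}-\breve\Psi^{m(q)}}{\tau}-V_{\infty,q}\frac{\breve\Psi^{m(q)}+\widetilde\Psi^{m(q)}}{2}\Bigr)\Bigr]\Big|_{j=J}=c_{\hbar,q}\bigl(R_q*\widetilde\Psi^{(q)}_J\bigr)^m$$ for any $m\ge1$ and $1\le q\le K-1$, where $$ c_{\hbar,q}:=c_\hbar\Bigl[1+\Bigl(\frac{h_xh_y\lambda_q}{12\sigma_q}\Bigr)^2\Bigr],\quad \theta_q:=\frac1{12\sigma_q}\in\Bigl(\frac1{12},\frac18\Bigr),\quad V_{\infty,q}:=V_\infty+c_\hbar\frac{\lambda_q}{\sigma_q}.$$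 The discrete convolution kernel $R_q$ can be computed by the recurrent formulas $$ R_q^0=c_{1q},\quad R_q^1=-c_{1q}\varkappa_q\mu_q,\quad R_q^m=\frac{2m-3}{m}\varkappa_q\mu_qR_q^{m-1}-\frac{m-3}{m}\varkappa_q^2R_q^{m-2}\ \text{ for } m\ge2,$$ with the coefficients defined by $$ c_{1q}=-\frac{|\alpha_q|^{1/2}}{2}e^{-i(\arg\alpha_q)/2},\quad \varkappa_q=-e^{i\arg\alpha_q},\quad \arg\alpha_q\in(0,2\pi),\quad \mu_q=\frac{\beta_q}{|\alpha_q|}\in(-1,1),$$ $$ \alpha_q=2a_q+(1-4\theta_q)h_x^2a_q^2\ne0,\quad \beta_q=2\operatorname{Re}a_q+(1-4\theta_q)h_x^2|a_q|^2,\quad a_q=\frac{V_{\infty,q}}{2c_{\hbar,q}}+i\frac{\hbar}{\tau c_{\hbar,q}}.$$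
   Context: Constants: $\hbar>0$, $m_0>0$, $c_\hbar:=\hbar^2/(2m_0)$; $i$ is the imaginary unit. $Y>0$, $X>X_0>0$. The potential $V(x,y)$ is a given real function on the semi-infinite strip $(0,\infty)\times(0,Y)$ with $V(x,y)=V_\infty$ (a constant) for $x\ge X_0$, $0<y<Y$. The auxiliary potential $\tilde V=\tilde V(x)$ is real, depends only on $x$, and satisfies $\tilde V(x)=V_\infty$ for $x\ge X_0$. Space mesh: $x_j=jh_x$, $j\ge0$, $h_x=X/J$, with $h_x\le X-X_0$; $y_k=kh_y$, $0\le k\le K$, $h_y=Y/K$. $\overline\omega_{h,\infty}=\{(x_j,y_k): j\ge0,\ 0\le k\le K\}$, $\omega_{h,\infty}=\{(x_j,y_k): j\ge1,\ 1\le k\le K-1\}$, $\Gamma_{h,\infty}=\overline\omega_{h,\infty}\setminus\omega_{h,\infty}$. Finite mesh: $\overline\omega_h=\{(x_j,y_k)\in\overline\omega_{h,\infty}: 0\le j\le J\}$, $\omega_h=\{(x_j,y_k): 1\le j\le J-1,\ 1\le k\le K-1\}$, $\partial\omega_h=\overline\omega_h\setminus\omega_h$, $\Gamma_{1h}=\{(x_J,y_k): 1\le k\le K-1\}$, $\Gamma_h=\partial\omega_h\setminus\Gamma_{1h}$. Time mesh: uniform with step $\tau>0$, $t_m=m\tau$, $m\ge0$; the superscript $m$ denotes the time level. Difference operators: $\bar\partial_xW_j=(W_j-W_{j-1})/h_x$, $\partial_xW_j=(W_{j+1}-W_j)/h_x$, and similarly $\bar\partial_y,\partial_y$ in the index $k$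 with step $h_y$; $s_{Nx}=I+\frac{h_x^2}{12}\partial_x\bar\partial_x$, $s_{Ny}=I+\frac{h_y^2}{12}\partial_y\bar\partial_y$; $s_N=I+\frac{h_x^2}{12}\partial_x\bar\partial_x+\frac{h_y^2}{12}\partial_y\bar\partial_y$; $\Delta_{hN}=s_{Ny}\partial_x\bar\partial_x+s_{Nx}\partial_y\bar\partial_y$; $s^-_{\theta x}W_j=\theta W_{j-1}+(\frac12-\theta)W_j$. $H_h$ is the Hilbert space of mesh functions $W:\overline\omega_{h,\infty}\to\mathbb C$ with $W|_{\Gamma_{h,\infty}}=0$ and $\sum_{j=1}^\infty\sum_{k=1}^{K-1}|W_{j,k}|^2<\infty$. The compatibility condition $\Psi^0_h|_{\Gamma_{h,\infty}}=0$ is assumed; thus $\Psi_h^0\in H_h$, and $F^m\in H_h$ for $m\ge 1$. Discrete sine transform in $y$: $Z^{(q)}=(\mathcal F_yZ)^{(q)}=\frac2K\sum_{k=1}^{K-1}Z_k\sin\frac{\pi qk}{K}$, $1\le q\le K-1$ (applied for each fixed $j$ and $m$; $Z^{m(q)}=(Z^m)^{(q)}$). $\lambda_q=\bigl(\frac2{h_y}\sin\frac{\pi qh_y}{2Y}\bigr)^2$ and $\sigma_q=1-\frac{h_y^2}{12}\lambda_q\in(\frac23,1)$ are the corresponding eigenvalues of $-\partial_y\bar\partial_y$ and $s_{Ny}$. A subscript $J$ (as in $\widetilde\Psi_J^{(q)}$) denotes the value at $x=x_J$. Discrete convolution in time: $(R*Q)^m=\sum_{p=0}^mR^pQ^{m-p}$,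 $m\ge0$. In the convolution, $\widetilde\Psi^0_J:=\Psi^0_J$ $(=0)$. *)

theory Defs
  imports "HOL-Analysis.Complex_Transcendental"
begin

record params =
  hbar  :: real
  m0    :: real
  X_dom :: real  \<comment> \<open>the length X of the finite mesh\<close>
  X_pot :: real  \<comment> \<open>the abscissa X0 from which on the potentials are constant\<close>
  Y_dom :: real
  J_num :: nat
  K_num :: nat
  tau   :: real
  V_inf :: real

definition hx :: "params \<Rightarrow> real" where "hx P = X_dom P / real (J_num P)"
definition hy :: "params \<Rightarrow> real" where "hy P = Y_dom P / real (K_num P)"
definition xnode :: "params \<Rightarrow> nat \<Rightarrow> real" where "xnode P j = real j * hx P"
definition ynode :: "params \<Rightarrow> nat \<Rightarrow> real" where "ynode P k = real k * hy P"
definition c_hbar :: "params \<Rightarrow> real" where "c_hbar P = (hbar P)\<^sup>2 / (2 * m0 P)"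

text \<open>Meshes are sets of index pairs (j, k); the pair stands for the node
  (xnode j, ynode k). A mesh function is a function of these indices, and its
  values at indices k above K carry no meaning and are never used.\<close>

type_synonym mesh_fun = "nat \<Rightarrow> nat \<Rightarrow> complex"

definition cl_omega_inf :: "params \<Rightarrow> (nat \<times> nat) set" where
  "cl_omega_inf P = {(j, k). k \<le> K_num P}"

definition omega_inf :: "params \<Rightarrow> (nat \<times> nat) set" where
  "omega_inf P = {(j, k). 1 \<le> j \<and> 1 \<le> k \<and> k \<le> K_num P - 1}"

definition Gamma_inf :: "params \<Rightarrow> (nat \<times> nat) set" where
  "Gamma_inf P = cl_omega_inf P - omega_inf P"

definition cl_omega :: "params \<Rightarrow> (nat \<times> nat) set" where
  "cl_omega P = {(j, k) \<in> cl_omega_inf P. j \<le> J_num P}"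

definition omega :: "params \<Rightarrow> (nat \<times> nat) set" where
  "omega P = {(j, k). 1 \<le> j \<and> j \<le> J_num P - 1 \<and> 1 \<le> k \<and> k \<le> K_num P - 1}"

definition bd_omega :: "params \<Rightarrow> (nat \<times> nat) set" where
  "bd_omega P = cl_omega P - omega P"

definition Gamma1 :: "params \<Rightarrow> (nat \<times> nat) set" where
  "Gamma1 P = {(j, k). j = J_num P \<and> 1 \<le> k \<and> k \<le> K_num P - 1}"

definition Gamma_fin :: "params \<Rightarrow> (nat \<times> nat) set" where
  "Gamma_fin P = bd_omega P - Gamma1 P"

definition zero_on :: "mesh_fun \<Rightarrow> (nat \<times> nat) set \<Rightarrow> bool" where
  "zero_on W D \<longleftrightarrow> (\<forall>(j, k) \<in> D. W j k = 0)"

definition H_space :: "params \<Rightarrow> mesh_fun set" where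
  "H_space P = {W. zero_on W (Gamma_inf P) \<and>
     summable (\<lambda>j. \<Sum>k = 1..K_num P - 1. (cmod (W (Suc j) k))\<^sup>2)}"

text \<open>One-dimensional difference operators. The backward operators are meaningful only
  at indices n > 0 (truncated subtraction at n = 0), and are only evaluated there in the schemes.\<close>

definition bdiff :: "real \<Rightarrow> (nat \<Rightarrow> complex) \<Rightarrow> nat \<Rightarrow> complex" where
  "bdiff h w n = (w n - w (n - 1)) / complex_of_real h"

definition fdiff :: "real \<Rightarrow> (nat \<Rightarrow> complex) \<Rightarrow> nat \<Rightarrow> complex" where
  "fdiff h w n = (w (n + 1) - w n) / complex_of_real h"

definition s_minus :: "real \<Rightarrow> (nat \<Rightarrow> complex) \<Rightarrow> nat \<Rightarrow> complex" where
  "s_minus \<theta> w n = complex_of_real \<theta> * w (n - 1) + complex_of_real (1/2 - \<theta>) * w n"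

definition dxx :: "params \<Rightarrow> mesh_fun \<Rightarrow> mesh_fun" where
  "dxx P W = (\<lambda>j k. fdiff (hx P) (bdiff (hx P) (\<lambda>i. W i k)) j)"

definition dyy :: "params \<Rightarrow> mesh_fun \<Rightarrow> mesh_fun" where
  "dyy P W = (\<lambda>j k. fdiff (hy P) (bdiff (hy P) (\<lambda>l. W j l)) k)"

definition s_Nx :: "params \<Rightarrow> mesh_fun \<Rightarrow> mesh_fun" where
  "s_Nx P W = (\<lambda>j k. W j k + complex_of_real ((hx P)\<^sup>2 / 12) * dxx P W j k)"

definition s_Ny :: "params \<Rightarrow> mesh_fun \<Rightarrow> mesh_fun" where
  "s_Ny P W = (\<lambda>j k. W j k + complex_of_real ((hy P)\<^sup>2 / 12) * dyy P W j k)"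

definition s_N :: "params \<Rightarrow> mesh_fun \<Rightarrow> mesh_fun" where
  "s_N P W = (\<lambda>j k. W j k + complex_of_real ((hx P)\<^sup>2 / 12) * dxx P W j k
                        + complex_of_real ((hy P)\<^sup>2 / 12) * dyy P W j k)"

definition Delta_hN :: "params \<Rightarrow> mesh_fun \<Rightarrow> mesh_fun" where
  "Delta_hN P W = (\<lambda>j k. s_Ny P (dxx P W) j k + s_Nx P (dyy P W) j k)"

text \<open>The steps of the splitting scheme from time level m - 1 to m, on a set D of nodes.
  The potential step (a half time step) leads from U to W, and the kinetic step from B to T.\<close>

definition potential_step ::
  "params \<Rightarrow> (real \<Rightarrow> real \<Rightarrow> real) \<Rightarrow> (real \<Rightarrow> real) \<Rightarrow> (nat \<times> nat) set \<Rightarrow>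
   mesh_fun \<Rightarrow> mesh_fun \<Rightarrow> bool" where
  "potential_step P V Vt D U W \<longleftrightarrow> (\<forall>(j, k) \<in> D.
     \<i> * complex_of_real (hbar P) * ((W j k - U j k) / complex_of_real (tau P / 2)) =
     complex_of_real (V (xnode P j) (ynode P k) - Vt (xnode P j)) * ((W j k + U j k) / 2))"

definition kinetic_step ::
  "params \<Rightarrow> (real \<Rightarrow> real) \<Rightarrow> (nat \<times> nat) set \<Rightarrow> mesh_fun \<Rightarrow>
   mesh_fun \<Rightarrow> mesh_fun \<Rightarrow> bool" where
  "kinetic_step P Vt D F B T \<longleftrightarrow> (\<forall>(j, k) \<in> D.
     \<i> * complex_of_real (hbar P) *
       s_N P (\<lambda>j k. (T j k - B j k) / complex_of_real (tau P)) j k =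
     - complex_of_real (c_hbar P) * Delta_hN P (\<lambda>j k. (T j k + B j k) / 2) j k
     + s_N P (\<lambda>j k. complex_of_real (Vt (xnode P j)) * ((T j k + B j k) / 2)) j k
     + F j k)"

definition dst :: "params \<Rightarrow> nat \<Rightarrow> (nat \<Rightarrow> complex) \<Rightarrow> complex" where
  "dst P q Z = complex_of_real (2 / real (K_num P)) *
     (\<Sum>k = 1..K_num P - 1. Z k * complex_of_real (sin (pi * real q * real k / real (K_num P))))"

definition dconv :: "(nat \<Rightarrow> complex) \<Rightarrow> (nat \<Rightarrow> complex) \<Rightarrow> nat \<Rightarrow> complex" where
  "dconv R Q m = (\<Sum>p = 0..m. R p * Q (m - p))"

definition lam :: "params \<Rightarrow> nat \<Rightarrow> real" where
  "lam P q = (2 / hy P * sin (pi * real q * hy P / (2 * Y_dom P)))\<^sup>2"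

definition sig :: "params \<Rightarrow> nat \<Rightarrow> real" where
  "sig P q = 1 - (hy P)\<^sup>2 / 12 * lam P q"

definition c_hbar_q :: "params \<Rightarrow> nat \<Rightarrow> real" where
  "c_hbar_q P q = c_hbar P * (1 + (hx P * hy P * lam P q / (12 * sig P q))\<^sup>2)"

definition theta_q :: "params \<Rightarrow> nat \<Rightarrow> real" where
  "theta_q P q = 1 / (12 * sig P q)"

definition V_inf_q :: "params \<Rightarrow> nat \<Rightarrow> real" where
  "V_inf_q P q = V_inf P + c_hbar P * (lam P q / sig P q)"

definition a_q :: "params \<Rightarrow> nat \<Rightarrow> complex" where
  "a_q P q = complex_of_real (V_inf_q P q / (2 * c_hbar_q P q))
           + \<i> * complex_of_real (hbar P / (tau P * c_hbar_q P q))"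

definition alpha_q :: "params \<Rightarrow> nat \<Rightarrow> complex" where
  "alpha_q P q = 2 * a_q P q
     + complex_of_real ((1 - 4 * theta_q P q) * (hx P)\<^sup>2) * (a_q P q)\<^sup>2"

definition beta_q :: "params \<Rightarrow> nat \<Rightarrow> real" where
  "beta_q P q = 2 * Re (a_q P q)
     + (1 - 4 * theta_q P q) * (hx P)\<^sup>2 * (cmod (a_q P q))\<^sup>2"

definition arg_alpha_q :: "params \<Rightarrow> nat \<Rightarrow> real" where
  "arg_alpha_q P q = Arg2pi (alpha_q P q)"

definition c1_q :: "params \<Rightarrow> nat \<Rightarrow> complex" where
  "c1_q P q = - complex_of_real (sqrt (cmod (alpha_q P q)) / 2) * cis (- (arg_alpha_q P q / 2))"

definition kappa_q :: "params \<Rightarrow> nat \<Rightarrow> complex" where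
  "kappa_q P q = - cis (arg_alpha_q P q)"

definition mu_q :: "params \<Rightarrow> nat \<Rightarrow> real" where
  "mu_q P q = beta_q P q / cmod (alpha_q P q)"

fun R_q :: "params \<Rightarrow> nat \<Rightarrow> nat \<Rightarrow> complex" where
  "R_q P q 0 = c1_q P q"
| "R_q P q (Suc 0) = - c1_q P q * kappa_q P q * complex_of_real (mu_q P q)"
| "R_q P q (Suc (Suc n)) = (let m = real (n + 2) in
     complex_of_real ((2 * m - 3) / m) * kappa_q P q * complex_of_real (mu_q P q) * R_q P q (Suc n)
     - complex_of_real ((m - 3) / m) * (kappa_q P q)\<^sup>2 * R_q P q n)"

text \<open>The discrete transparent boundary condition at x = X for the mode q and the time level m.
  In the convolution, level 0 of the sequence T is replaced by level 0 of the sequence S.\<close>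

definition dtbc :: "params \<Rightarrow> (nat \<Rightarrow> mesh_fun) \<Rightarrow> (nat \<Rightarrow> mesh_fun) \<Rightarrow>
    (nat \<Rightarrow> mesh_fun) \<Rightarrow> nat \<Rightarrow> nat \<Rightarrow> bool" where
  "dtbc P B T S q m \<longleftrightarrow>
     (let Bq = (\<lambda>j. dst P q (B m j)); Tq = (\<lambda>j. dst P q (T m j)) in
      complex_of_real (c_hbar_q P q) * bdiff (hx P) (\<lambda>j. (Tq j + Bq j) / 2) (J_num P)
      - complex_of_real (hx P) * s_minus (theta_q P q)
          (\<lambda>j. \<i> * complex_of_real (hbar P) * ((Tq j - Bq j) / complex_of_real (tau P))
               - complex_of_real (V_inf_q P q) * ((Bq j + Tq j) / 2)) (J_num P)
      = complex_of_real (c_hbar_q P q) *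
        dconv (R_q P q) (\<lambda>p. dst P q ((T(0 := S 0)) p (J_num P))) m)"

end

theory Submission
  imports Defs "HOL-Computational_Algebra.Formal_Power_Series"
begin

text \<open>For \<open>j \<ge> J - 1\<close> the two potential steps are trivial, and a sine transform in \<open>y\<close>
  turns the scheme into a one-dimensional recurrence for each mode. Encoding the time levels as
  coefficients of formal power series \<open>U\<^sub>j\<close>, it reads
  \<open>p (U\<^sub>j\<^sub>+\<^sub>1 - 2 U\<^sub>j + U\<^sub>j\<^sub>-\<^sub>1) = 2 g U\<^sub>j\<close> with \<open>p\<close> and \<open>g\<close> linear in the series variable.
  If \<open>R\<^sup>2 = 2 p g + g\<^sup>2\<close>, the defect \<open>W\<^sub>j = (p + g - R) U\<^sub>j - p U\<^sub>j\<^sub>-\<^sub>1\<close> of the boundary condition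
  satisfies \<open>p W\<^sub>j\<^sub>+\<^sub>1 = (p + g - R) W\<^sub>j\<close>; for the right branch of \<open>R\<close> its lowest nonzero coefficient
  would grow in \<open>j\<close>, whereas the coefficients of \<open>U\<^sub>j\<close> tend to zero, so \<open>W\<^sub>j = 0\<close>. No convergence
  in the series variable is needed. The kernel \<open>R\<^sub>q\<close> is this square root: its square is the
  quadratic with coefficients \<open>cnj \<alpha>\<^sub>q / 4\<close>, \<open>\<beta>\<^sub>q / 2\<close>, \<open>\<alpha>\<^sub>q / 4\<close>.\<close>

unbundle fps_syntax
unbundle no vec_syntax

section \<open>Formal power series: decaying recurrences and square roots\<close>

text \<open>Induction on the coefficient index, for all \<open>j\<close> at once: when the lower
  coefficients vanish, coefficient \<open>m\<close> of a product sees only the constant terms of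
  \<open>p\<close> and \<open>s\<close>. The recurrence then makes \<open>cmod (W j $ m)\<close>
  nondecreasing in \<open>j\<close>, and a nondecreasing nonnegative sequence with limit zero
  vanishes.\<close>

lemma fps_recurrence_vanishing:
  fixes p s :: "complex fps" and W :: "nat \<Rightarrow> complex fps"
  assumes rec: "\<And>j. p * W (Suc j) = s * W j"
    and grow: "cmod (p $ 0) < cmod (s $ 0)"
    and decay: "\<And>m. (\<lambda>j. W j $ m) \<longlonglongrightarrow> 0"
  shows "W j = 0"
proof -
  have "\<forall>j. W j $ m = 0" for m
  proof (induction m rule: less_induct)
    case (less m)
    have coeff: "(q * W j) $ m = q $ 0 * W j $ m" for q j
    proof -
      have "(q * W j) $ m = (\<Sum>i=0..m. if i = 0 then q $ 0 * W j $ m else 0)"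
        unfolding fps_mult_nth using less.IH by (intro sum.cong) auto
      then show ?thesis by simp
    qed
    have mono: "cmod (W j $ m) \<le> cmod (W (Suc j) $ m)" for j
    proof -
      \<comment> \<open>As \<open>p $ 0\<close> may vanish, the factor to cancel is
        \<open>s $ 0\<close>, nonzero by \<open>grow\<close>.\<close>
      have "cmod (s $ 0) * cmod (W j $ m) = cmod (p $ 0) * cmod (W (Suc j) $ m)"
        using rec[of j] coeff by (metis norm_mult)
      also have "\<dots> \<le> cmod (s $ 0) * cmod (W (Suc j) $ m)"
        using grow by (intro mult_right_mono) auto
      finally show ?thesis using grow le_less_trans[OF norm_ge_zero grow] by simp
    qed
    have "incseq (\<lambda>j. cmod (W j $ m))" using mono by (rule incseq_SucI)
    moreover have "(\<lambda>j. cmod (W j $ m)) \<longlonglongrightarrow> 0"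
      using decay by (simp add: tendsto_norm_zero)
    ultimately show ?case using incseq_le by fastforce
  qed
  then show ?thesis by (simp add: fps_eq_iff)
qed

text \<open>The characteristic polynomial \<open>p z^2 - 2 (p + g) z + p\<close> has discriminant
  \<open>4 R^2\<close> and formal roots \<open>(p + g + R) / p\<close> and
  \<open>(p + g - R) / p\<close> with product 1. \<open>W\<close> eliminates the first root, so it
  evolves by the second alone, which \<open>branch\<close> makes expanding in the constant
  coefficient.\<close>

lemma fps_transparent_boundary:
  fixes p g R :: "complex fps" and U :: "nat \<Rightarrow> complex fps"
  assumes eq: "\<And>j. p * (U (j + 2) - 2 * U (j + 1) + U j) = 2 * g * U (j + 1)"
    and R: "R\<^sup>2 = 2 * p * g + g\<^sup>2"
    and branch: "cmod (p $ 0) < cmod (p $ 0 + g $ 0 - R $ 0)"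
    and decay: "\<And>m. (\<lambda>j. U j $ m) \<longlonglongrightarrow> 0"
  shows "p * (U 1 - U 0) + g * U 1 = R * U 1"
proof -
  define W where "W j = (p + g - R) * U (j + 1) - p * U j" for j
  have decay_mult: "(\<lambda>j. (q * U (j + i)) $ m) \<longlonglongrightarrow> 0" for q i m
    unfolding fps_mult_nth
    by (rule tendsto_null_sum) (intro tendsto_mult_right_zero LIMSEQ_ignore_initial_segment decay)
  have "W 0 = 0"
  proof (rule fps_recurrence_vanishing[where W = W and p = p and s = "p + g - R"])
    show "p * W (Suc j) = (p + g - R) * W j" for j
      using eq[of j] R unfolding W_def by (simp, algebra)
    show "cmod (p $ 0) < cmod ((p + g - R) $ 0)" using branch by simp
    show "(\<lambda>j. W j $ m) \<longlonglongrightarrow> 0" for m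
      using tendsto_diff[OF decay_mult[of "p + g - R" 1 m] decay_mult[of p 0 m]]
      by (simp add: W_def)
  qed
  then show ?thesis unfolding W_def by (simp add: algebra_simps)
qed

text \<open>The recurrence says that \<open>r\<close> solves \<open>Q r' = Q' r / 2\<close> for the quadratic \<open>Q\<close>
  below, so that \<open>r\<^sup>2 / Q\<close> has derivative zero.\<close>

lemma fps_square_of_recurrence:
  fixes r :: "nat \<Rightarrow> complex" and b d :: complex
  assumes r1: "r (Suc 0) = - r 0 * b"
    and rec: "\<And>n. of_nat (n + 2) * r (n + 2) =
      of_nat (2 * n + 1) * b * r (n + 1) - (of_nat n - 1) * d * r n"
  shows "(Abs_fps r)\<^sup>2 =
    fps_const ((r 0)\<^sup>2) * (1 - fps_const (2 * b) * fps_X + fps_const d * fps_X\<^sup>2)"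
proof -
  define f where "f = Abs_fps r"
  define Q where "Q = 1 - fps_const (2 * b) * fps_X + fps_const d * fps_X\<^sup>2"
  have Q0: "Q $ 0 = 1" by (simp add: Q_def)
  have Q_nonzero: "Q \<noteq> 0" using Q0 by auto
  have Q': "fps_deriv Q = 2 * (fps_const d * fps_X - fps_const b)"
  proof -
    have "fps_const (2 * b) = 2 * fps_const b"
      by (metis fps_const_mult numeral_fps_const)
    then show ?thesis by (simp add: Q_def power2_eq_square algebra_simps)
  qed
  have ode: "Q * fps_deriv f = (fps_const d * fps_X - fps_const b) * f"
  proof (rule fps_ext)
    fix n :: nat
    have lhs: "Q * fps_deriv f = fps_deriv f - fps_const (2 * b) * (fps_X * fps_deriv f)
        + fps_const d * (fps_X * (fps_X * fps_deriv f))"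
      by (simp add: Q_def algebra_simps power2_eq_square)
    have rhs: "(fps_const d * fps_X - fps_const b) * f = fps_const d * (fps_X * f) - fps_const b * f"
      by (simp add: algebra_simps)
    \<comment> \<open>Coefficient \<open>n\<close> of the equation is \<open>r1\<close> for
      \<open>n = 0\<close> and the recurrence at \<open>n - 1\<close> otherwise;
      \<open>n = 1\<close> is separate because the term shifted by two does not reach it.\<close>
    consider "n = 0" | "n = 1" | l where "n = l + 2"
      by (metis One_nat_def add_2_eq_Suc' not0_implies_Suc)
    then show "(Q * fps_deriv f) $ n = ((fps_const d * fps_X - fps_const b) * f) $ n"
    proof cases
      case 1
      then show ?thesis unfolding lhs rhs by (simp add: f_def r1)
    next
      case 2
      then show ?thesis unfolding lhs rhs using rec[of 0]
        by (simp add: f_def r1 numeral_2_eq_2 algebra_simps)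
    next
      case 3
      then show ?thesis unfolding lhs rhs using rec[of "l + 1"]
        by (simp add: f_def algebra_simps)
    qed
  qed
  have "fps_deriv (f\<^sup>2 * inverse Q) = 0"
  proof -
    have inv: "Q * inverse Q = 1" using Q0 by (simp add: inverse_mult_eq_1')
    have "fps_deriv (f\<^sup>2 * inverse Q)
        = 2 * f * fps_deriv f * inverse Q - f\<^sup>2 * (fps_deriv Q * (inverse Q)\<^sup>2)"
      using Q0 by (simp add: fps_inverse_deriv power2_eq_square algebra_simps)
    \<comment> \<open>Two factors \<open>Q\<close> clear the inverses; they can be cancelled
      afterwards, as there are no zero divisors.\<close>
    then have "Q * Q * fps_deriv (f\<^sup>2 * inverse Q) = 2 * f * (Q * fps_deriv f) - fps_deriv Q * f\<^sup>2"
      using inv by algebra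
    also have "\<dots> = 0" unfolding ode Q' by (simp add: power2_eq_square algebra_simps)
    finally show ?thesis using Q_nonzero by simp
  qed
  then have "f\<^sup>2 * inverse Q = fps_const ((f\<^sup>2 * inverse Q) $ 0)"
    by (simp only: fps_deriv_eq_0_iff)
  also have "(f\<^sup>2 * inverse Q) $ 0 = (r 0)\<^sup>2"
    using Q0 by (simp add: power2_eq_square f_def)
  finally have "f\<^sup>2 * (inverse Q * Q) = fps_const ((r 0)\<^sup>2) * Q"
    by (metis mult.assoc)
  then show ?thesis using Q0 by (simp add: inverse_mult_eq_1 f_def Q_def)
qed

section \<open>Square roots in the upper half plane and the branch of the kernel\<close>

lemma csqrt_first_quadrant:
  assumes "0 < Im z"
  shows "0 < Re (csqrt z)" and "0 < Im (csqrt z)"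
proof -
  have "Im z = 2 * Re (csqrt z) * Im (csqrt z)"
    using Im_power2[of "csqrt z"] by simp
  moreover have "0 < Re (csqrt z) \<or> Re (csqrt z) = 0" using csqrt_principal[of z] by blast
  ultimately show "0 < Re (csqrt z)" "0 < Im (csqrt z)"
    using assms by (auto simp: zero_less_mult_iff)
qed

text \<open>Half of an argument in \<open>[0, 2 pi)\<close> lies in \<open>[0, pi)\<close>, so the
  root built from it has nonnegative imaginary part. The two roots differ by sign, hence it is the
  one in the upper half plane; argument zero would make that root real.\<close>

lemma upper_sqrt_eq_Arg2pi:
  assumes "s\<^sup>2 = z" and "0 < Im s"
  shows "0 < Arg2pi z" and "s = of_real (sqrt (cmod z)) * cis (Arg2pi z / 2)"
proof -
  define r where "r = of_real (sqrt (cmod z)) * cis (Arg2pi z / 2)"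
  have "r\<^sup>2 = of_real (cmod z) * cis (Arg2pi z)"
    unfolding r_def power_mult_distrib Complex.DeMoivre of_real_power[symmetric] by simp
  also have "\<dots> = z" by (metis Arg2pi_eq cis_conv_exp)
  finally have "r = s \<or> r = - s" using assms(1) by (metis power2_eq_iff)
  moreover have "0 \<le> Im r"
    using Arg2pi_ge_0[of z] Arg2pi_lt_2pi[of z] by (simp add: r_def sin_ge_zero)
  ultimately have rs: "r = s" using assms(2) by auto
  then show "s = of_real (sqrt (cmod z)) * cis (Arg2pi z / 2)" by (simp add: r_def)
  show "0 < Arg2pi z"
    using rs assms(2) Arg2pi_ge_0[of z] by (cases "Arg2pi z = 0") (auto simp: r_def)
qed

text \<open>The product of the two roots bisects the angle between \<open>a\<close> and \<open>e\<close>.\<close>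

lemma Re_cnj_mult_csqrt_pos:
  assumes "0 < Im a" and "0 < Im e"
  shows "0 < Re (cnj e * (csqrt a * csqrt e))"
proof -
  define x y where "x = csqrt a" and "y = csqrt e"
  have "cnj e = (cnj y)\<^sup>2" by (simp add: y_def flip: complex_cnj_power)
  then have "cnj e * (x * y) = (cnj y * y) * (cnj y * x)"
    by (simp add: power2_eq_square)
  also have "cnj y * y = of_real ((cmod y)\<^sup>2)"
    by (metis complex_norm_square mult.commute)
  finally have eq: "cnj e * (x * y) = of_real ((cmod y)\<^sup>2) * (cnj y * x)" .
  \<comment> \<open>What remains is the scalar product of \<open>x\<close> and \<open>y\<close>, two
    vectors in the open first quadrant.\<close>
  have "Re (cnj e * (x * y)) = (cmod y)\<^sup>2 * (Re y * Re x + Im y * Im x)"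
    unfolding eq by (simp flip: of_real_power)
  moreover have "0 < Re x" "0 < Im x" "0 < Re y" "0 < Im y"
    unfolding x_def y_def by (fact csqrt_first_quadrant[OF assms(1)] csqrt_first_quadrant[OF assms(2)])+
  ultimately show ?thesis
    by (auto simp: x_def y_def intro!: mult_pos_pos add_pos_pos simp del: csqrt.sel)
qed

text \<open>As \<open>(t - r) (t + r) = p\<^sup>2\<close>, it suffices that \<open>t - r\<close> is the larger factor.\<close>

lemma cmod_less_of_obtuse:
  fixes p t r :: complex
  assumes "t\<^sup>2 - r\<^sup>2 = p\<^sup>2" and "Re (t * cnj r) < 0"
  shows "cmod p < cmod (t - r)"
proof -
  have "(cmod (t - r))\<^sup>2 - (cmod (t + r))\<^sup>2 = - 4 * Re (t * cnj r)"
    unfolding cmod_power2 by (simp add: power2_eq_square algebra_simps)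
  then have less: "cmod (t + r) < cmod (t - r)"
    using assms(2) power2_less_imp_less[of "cmod (t + r)" "cmod (t - r)"] by simp
  have "(cmod p)\<^sup>2 = cmod (t - r) * cmod (t + r)"
    unfolding norm_power[symmetric] norm_mult[symmetric] assms(1)[symmetric]
    by (simp add: algebra_simps power2_eq_square)
  also have "\<dots> < (cmod (t - r))\<^sup>2"
    unfolding power2_eq_square
    using less le_less_trans[OF norm_ge_zero less] by (intro mult_strict_left_mono)
  finally show ?thesis using power2_less_imp_less by fastforce
qed

lemma fps_linear_mult_nth:
  "((fps_const x + fps_const y * fps_X) * (f :: complex fps)) $ n
    = x * f $ n + (if n = 0 then 0 else y * f $ (n - 1))"
  by (simp add: distrib_right mult.assoc)

text \<open>The sum \<open>p + g\<close> is a positive combination of \<open>cnj e\<close> and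
  \<open>cnj a\<close>. By the bisection property each has positive scalar product with
  \<open>cnj (csqrt a * csqrt e)\<close>, so the minus sign in \<open>r\<close> makes the angle
  obtuse. The bound on \<theta> puts \<open>e\<close> into the upper half plane.\<close>

lemma branch_condition:
  fixes a p g :: complex and h \<theta> :: real
  assumes "0 < Im a" and "0 < h" and "\<theta> < 1 / 4"
  defines "e \<equiv> 2 + of_real ((1 - 4 * \<theta>) * h\<^sup>2) * a"
    and "p \<equiv> of_real (1 / (2 * h)) - of_real (\<theta> * h) * cnj a"
    and "g \<equiv> of_real (h / 2) * cnj a"
  defines "r \<equiv> - cnj (csqrt a * csqrt e) / 2"
  shows "cmod p < cmod (p + g - r)"
proof (rule cmod_less_of_obtuse)
  have Im_e: "0 < Im e" using assms(1-3) by (simp add: e_def)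
  have "r\<^sup>2 = cnj (a * e) / 4"
    by (simp add: r_def power_mult_distrib power_divide flip: complex_cnj_power)
  also have "\<dots> = (p + g)\<^sup>2 - p\<^sup>2"
    using assms(2) by (simp add: p_def g_def e_def field_simps power2_eq_square)
  finally show "(p + g)\<^sup>2 - r\<^sup>2 = p\<^sup>2" by simp
  have "p + g = of_real (1 / (4 * h)) * cnj e + of_real (h / 4) * cnj a"
    using assms(2) by (simp add: p_def g_def e_def field_simps power2_eq_square)
  then have eq: "(p + g) * cnj r = of_real (- 1 / (8 * h)) * (cnj e * (csqrt a * csqrt e))
      + of_real (- h / 8) * (cnj a * (csqrt e * csqrt a))"
    by (simp add: r_def algebra_simps)
  have "Re (of_real x * z + of_real y * w) = x * Re z + y * Re w" for x y z w
    by simp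
  then have "Re ((p + g) * cnj r) = - 1 / (8 * h) * Re (cnj e * (csqrt a * csqrt e))
      + - h / 8 * Re (cnj a * (csqrt e * csqrt a))"
    unfolding eq .
  moreover have "0 < 1 / (8 * h) * Re (cnj e * (csqrt a * csqrt e))"
    and "0 < h / 8 * Re (cnj a * (csqrt e * csqrt a))"
    using Re_cnj_mult_csqrt_pos[OF assms(1) Im_e] Re_cnj_mult_csqrt_pos[OF Im_e assms(1)] assms(2)
    by (intro mult_pos_pos; simp del: csqrt.sel times_complex.sel)+
  ultimately show "Re ((p + g) * cnj r) < 0" by linarith
qed

text \<open>The square of \<open>c1_q\<close> is \<open>cnj \<alpha> / 4\<close>, of argument
  \<open>- \<phi>\<close>. Each factor \<open>kappa_q\<close> turns it by \<phi> up to sign: one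
  makes the middle coefficient real, two lead to \<open>\<alpha> / 4\<close>.\<close>

lemma R_q_square:
  assumes "alpha_q P q \<noteq> 0"
  shows "(Abs_fps (R_q P q))\<^sup>2 = fps_const (cnj (alpha_q P q) / 4)
    + fps_const (of_real (beta_q P q / 2)) * fps_X + fps_const (alpha_q P q / 4) * fps_X\<^sup>2"
proof -
  define \<alpha> where "\<alpha> = alpha_q P q"
  define \<phi> where "\<phi> = Arg2pi \<alpha>"
  have \<alpha>: "\<alpha> = of_real (cmod \<alpha>) * cis \<phi>"
    unfolding \<phi>_def by (metis Arg2pi_eq cis_conv_exp)
  have cnj_\<alpha>: "cnj \<alpha> = of_real (cmod \<alpha>) * cis (- \<phi>)"
    by (subst \<alpha>) (simp add: cis_cnj)
  have c1: "(R_q P q 0)\<^sup>2 = of_real (cmod \<alpha> / 4) * cis (- \<phi>)"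
    unfolding R_q.simps c1_q_def arg_alpha_q_def \<alpha>_def[symmetric] \<phi>_def[symmetric]
    by (simp add: power_mult_distrib power_divide Complex.DeMoivre flip: of_real_power)
  have 0: "(R_q P q 0)\<^sup>2 = cnj \<alpha> / 4" unfolding c1 cnj_\<alpha> by simp
  have k: "kappa_q P q = - cis \<phi>"
    by (simp add: kappa_q_def arg_alpha_q_def \<alpha>_def \<phi>_def)
  have 1: "- (R_q P q 0)\<^sup>2 * (2 * (kappa_q P q * of_real (mu_q P q))) = of_real (beta_q P q / 2)"
    unfolding c1 k mu_q_def using assms
    by (simp add: \<alpha>_def cis_mult field_simps flip: cis_inverse)
  have 2: "(R_q P q 0)\<^sup>2 * (kappa_q P q)\<^sup>2 = \<alpha> / 4"
  proof -
    have "(R_q P q 0)\<^sup>2 * (kappa_q P q)\<^sup>2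
        = of_real (cmod \<alpha>) * (cis (- \<phi>) * (cis \<phi> * cis \<phi>)) / 4"
      unfolding c1 k by (simp add: power2_eq_square)
    also have "\<dots> = \<alpha> / 4" unfolding cis_mult by (simp flip: \<alpha>)
    finally show ?thesis .
  qed
  have "(Abs_fps (R_q P q))\<^sup>2 = fps_const ((R_q P q 0)\<^sup>2)
      * (1 - fps_const (2 * (kappa_q P q * of_real (mu_q P q))) * fps_X
         + fps_const ((kappa_q P q)\<^sup>2) * fps_X\<^sup>2)"
  proof (rule fps_square_of_recurrence)
    show "R_q P q (Suc 0) = - R_q P q 0 * (kappa_q P q * of_real (mu_q P q))" by simp
    show "of_nat (n + 2) * R_q P q (n + 2) =
        of_nat (2 * n + 1) * (kappa_q P q * of_real (mu_q P q)) * R_q P q (n + 1)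
        - (of_nat n - 1) * (kappa_q P q)\<^sup>2 * R_q P q n" for n
    proof -
      \<comment> \<open>With \<open>m = n + 2\<close> the coefficients \<open>2 m - 3\<close> and
        \<open>m - 3\<close> become \<open>2 n + 1\<close> and \<open>n - 1\<close>.\<close>
      define m where "m = real (n + 2)"
      have m: "m \<noteq> 0" "of_nat (n + 2) = complex_of_real m" by (simp_all add: m_def)
      have "R_q P q (n + 2) = complex_of_real ((2 * m - 3) / m) * kappa_q P q
          * of_real (mu_q P q) * R_q P q (n + 1)
          - of_real ((m - 3) / m) * (kappa_q P q)\<^sup>2 * R_q P q n"
        by (simp add: Let_def m_def)
      then have "of_nat (n + 2) * R_q P q (n + 2) = of_real (2 * m - 3) * kappa_q P q
          * of_real (mu_q P q) * R_q P q (n + 1)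
          - of_real (m - 3) * (kappa_q P q)\<^sup>2 * R_q P q n"
        using m by (simp add: field_simps)
      then show ?thesis by (simp add: m_def algebra_simps)
    qed
  qed
  also have "\<dots> = fps_const ((R_q P q 0)\<^sup>2)
      + fps_const (- (R_q P q 0)\<^sup>2 * (2 * (kappa_q P q * of_real (mu_q P q)))) * fps_X
      + fps_const ((R_q P q 0)\<^sup>2 * (kappa_q P q)\<^sup>2) * fps_X\<^sup>2"
    by (simp add: algebra_simps flip: fps_const_mult fps_const_neg)
  finally show ?thesis unfolding 1 2 unfolding 0 \<alpha>_def .
qed

section \<open>The sine transform in y and the kinetic step of a single mode\<close>

lemma sum_second_difference_by_parts:
  fixes w s :: "nat \<Rightarrow> 'a::comm_ring_1"
  shows "(\<Sum>k=1..n. (w (k + 1) - 2 * w k + w (k - 1)) * s k) =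
    (\<Sum>k=1..n. w k * (s (k + 1) - 2 * s k + s (k - 1)))
    + (w (n + 1) * s n - w n * s (n + 1)) - (w 1 * s 0 - w 0 * s 1)"
  by (induction n) (simp_all add: algebra_simps)

lemma dst_cong: "(\<And>k. 1 \<le> k \<Longrightarrow> k \<le> K_num P - 1 \<Longrightarrow> f k = g k) \<Longrightarrow> dst P q f = dst P q g"
  unfolding dst_def by (intro arg_cong2[where f = "(*)"] sum.cong) auto

lemma dst_zero [simp]: "dst P q (\<lambda>k. 0) = 0"
  by (simp add: dst_def)

lemma dst_add: "dst P q (\<lambda>k. f k + g k) = dst P q f + dst P q g"
  by (simp add: dst_def sum.distrib distrib_left distrib_right)

lemma dst_diff: "dst P q (\<lambda>k. f k - g k) = dst P q f - dst P q g"
  by (simp add: dst_def sum_subtractf left_diff_distrib right_diff_distrib)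

lemma dst_mult: "dst P q (\<lambda>k. c * f k) = c * dst P q f"
  by (simp add: dst_def sum_distrib_left mult_ac)

lemma dst_divide: "dst P q (\<lambda>k. f k / c) = dst P q f / c"
  using dst_mult[of P q "inverse c" f] by (simp add: field_simps)

lemmas dst_linear = dst_add dst_diff dst_mult dst_divide

text \<open>A closed form of \<open>fdiff h (bdiff h w)\<close>. Both truncate alike at index 0, so
  rewriting one into the other needs no side condition.\<close>

definition second_diff :: "real \<Rightarrow> (nat \<Rightarrow> complex) \<Rightarrow> nat \<Rightarrow> complex" where
  "second_diff h w n = (w (n + 1) - 2 * w n + w (n - 1)) / (of_real h)\<^sup>2"

lemma fdiff_bdiff: "fdiff h (bdiff h w) n = second_diff h w n"
  by (simp add: fdiff_def bdiff_def second_diff_def power2_eq_square flip: diff_divide_distrib)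

lemma dst_dxx: "dst P q (dxx P W j) = second_diff (hx P) (\<lambda>i. dst P q (W i)) j"
  by (simp add: dxx_def fdiff_bdiff second_diff_def dst_linear)

lemma sin_second_difference:
  assumes "1 \<le> k"
  shows "sin (x * real (k + 1)) - 2 * sin (x * real k) + sin (x * real (k - 1))
    = - 4 * (sin (x / 2))\<^sup>2 * sin (x * real k)"
proof -
  have "cos x = 1 - 2 * (sin (x / 2))\<^sup>2" using cos_double_sin[of "x / 2"] by simp
  moreover have "sin (x * real (k + 1)) + sin (x * real (k - 1)) = 2 * sin (x * real k) * cos x"
    using assms by (simp add: of_nat_diff algebra_simps sin_add sin_diff)
  ultimately show ?thesis by algebra
qed

text \<open>Summation by parts moves the second difference onto the sines, which are its
  eigenvectors. All boundary terms vanish, since both \<open>W j\<close> and the sines are zero at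
  indices 0 and \<open>K_num P\<close>.\<close>

lemma dst_dyy:
  assumes "0 < Y_dom P" and "1 \<le> K_num P" and "W j 0 = 0" and "W j (K_num P) = 0"
  shows "dst P q (dyy P W j) = - of_real (lam P q) * dst P q (W j)"
proof -
  define K where "K = K_num P"
  define x where "x = pi * real q / real K"
  define s where "s k = complex_of_real (sin (x * real k))" for k
  have K: "1 \<le> K" using assms by (simp add: K_def)
  have "dst P q Z = of_real (2 / real K) * (\<Sum>k=1..K - 1. Z k * s k)" for Z
    by (simp add: dst_def s_def x_def K_def)
  note dst_eq = this
  have lam: "lam P q = 4 * (sin (x / 2))\<^sup>2 / (hy P)\<^sup>2"
    using assms by (simp add: lam_def hy_def x_def K_def power_mult_distrib power_divide mult_ac)
  have "s K = 0" using K sin_npi[of q] by (simp add: s_def x_def mult.commute)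
  then have "(\<Sum>k=1..K - 1. (W j (k + 1) - 2 * W j k + W j (k - 1)) * s k) =
      (\<Sum>k=1..K - 1. W j k * (s (k + 1) - 2 * s k + s (k - 1)))"
    using assms K sum_second_difference_by_parts[of "W j" s "K - 1"] by (simp add: s_def K_def)
  also have "\<dots> = (\<Sum>k=1..K - 1. of_real (- 4 * (sin (x / 2))\<^sup>2) * (W j k * s k))"
  proof (rule sum.cong)
    fix k assume "k \<in> {1..K - 1}"
    then have "s (k + 1) - 2 * s k + s (k - 1) = of_real (- 4 * (sin (x / 2))\<^sup>2 * sin (x * real k))"
      unfolding s_def by (subst sin_second_difference[symmetric]) auto
    then show "W j k * (s (k + 1) - 2 * s k + s (k - 1)) = of_real (- 4 * (sin (x / 2))\<^sup>2) * (W j k * s k)"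
      by (simp add: s_def)
  qed simp
  finally have "(\<Sum>k=1..K - 1. (W j (k + 1) - 2 * W j k + W j (k - 1)) * s k) =
      of_real (- 4 * (sin (x / 2))\<^sup>2) * (\<Sum>k=1..K - 1. W j k * s k)"
    by (simp only: sum_distrib_left)
  then show ?thesis
    unfolding dst_eq lam
    by (simp add: dyy_def fdiff_bdiff second_diff_def flip: sum_divide_distrib)
qed

context
  fixes P :: params and W :: mesh_fun and q :: nat
  assumes Y_pos: "0 < Y_dom P" and K_pos: "1 \<le> K_num P"
    and lower: "\<And>i. W i 0 = 0" and upper: "\<And>i. W i (K_num P) = 0"
begin

lemma dst_s_N: "dst P q (s_N P W j) = of_real (sig P q) * dst P q (W j)
    + of_real ((hx P)\<^sup>2 / 12) * second_diff (hx P) (\<lambda>i. dst P q (W i)) j"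
  unfolding s_N_def dst_linear dst_dxx dst_dyy[OF Y_pos K_pos lower upper] sig_def
  by (simp add: algebra_simps)

lemma dst_Delta_hN: "dst P q (Delta_hN P W j) =
    of_real (sig P q - (hx P)\<^sup>2 / 12 * lam P q) * second_diff (hx P) (\<lambda>i. dst P q (W i)) j
    - of_real (lam P q) * dst P q (W j)"
proof -
  \<comment> \<open>Differences in x preserve the zero values at \<open>k = 0\<close> and
    \<open>k = K_num P\<close>, so \<open>dst_dyy\<close> applies to \<open>dxx P W\<close>
    too.\<close>
  have "dst P q (dyy P (dxx P W) j) = - of_real (lam P q) * dst P q (dxx P W j)"
    using Y_pos K_pos lower upper
    by (intro dst_dyy) (simp_all add: dxx_def fdiff_bdiff second_diff_def)
  moreover have "dst P q (dyy P W i) = - of_real (lam P q) * dst P q (W i)" for i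
    using Y_pos K_pos lower upper by (intro dst_dyy)
  ultimately show ?thesis
    by (simp add: Delta_hN_def s_Nx_def s_Ny_def dst_linear dst_dxx sig_def)
       (simp add: second_diff_def algebra_simps add_divide_distrib diff_divide_distrib)
qed

end

lemma second_diff_linear:
  "second_diff h (\<lambda>i. x * f i - y * g i) n = x * second_diff h f n - y * second_diff h g n"
  by (simp add: second_diff_def algebra_simps add_divide_distrib diff_divide_distrib)

text \<open>Division of the transformed equation by \<open>sig P q\<close> turns the average in x
  into one with weight \<open>theta_q\<close>. Moving the term with \<open>lam\<close> into the
  potential \<open>V_inf_q\<close> under this average costs a multiple of the second difference;
  since \<open>1 - sig\<close> is \<open>hy^2 * lam / 12\<close>, that cost is exactly the
  correction in \<open>c_hbar_q\<close>.\<close>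

lemma kinetic_step_mode:
  assumes "0 < Y_dom P" and "1 \<le> K_num P" and sig: "sig P q \<noteq> 0"
    and B: "\<And>i. B i 0 = 0" "\<And>i. B i (K_num P) = 0"
    and T: "\<And>i. T i 0 = 0" "\<And>i. T i (K_num P) = 0"
    and kin: "kinetic_step P Vt D F B T"
    and D: "\<And>k. 1 \<le> k \<Longrightarrow> k \<le> K_num P - 1 \<Longrightarrow> (j, k) \<in> D \<and> F j k = 0"
    and Vt: "Vt (xnode P (j - 1)) = V_inf P" "Vt (xnode P j) = V_inf P" "Vt (xnode P (j + 1)) = V_inf P"
  defines "d \<equiv> \<lambda>i. (dst P q (T i) - dst P q (B i)) / of_real (tau P)"
    and "a \<equiv> \<lambda>i. (dst P q (T i) + dst P q (B i)) / 2"
  defines "v \<equiv> \<lambda>i. \<i> * of_real (hbar P) * d i - of_real (V_inf_q P q) * a i"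
  shows "v j + of_real (theta_q P q * (hx P)\<^sup>2) * second_diff (hx P) v j
    = - of_real (c_hbar_q P q) * second_diff (hx P) a j"
proof -
  define dm am where "dm = (\<lambda>i k. (T i k - B i k) / complex_of_real (tau P))"
    and "am = (\<lambda>i k. (T i k + B i k) / 2)"
  have dst_dm: "dst P q (dm i) = d i" and dst_am: "dst P q (am i) = a i" for i
    by (simp_all add: dm_def am_def d_def a_def dst_linear)
  have zero: "dm i 0 = 0" "dm i (K_num P) = 0" "am i 0 = 0" "am i (K_num P) = 0" for i
    using B T by (simp_all add: dm_def am_def)
  define \<sigma> h where "\<sigma> = sig P q" and "h = (hx P)\<^sup>2 / 12"
  define d2 a2 where "d2 = second_diff (hx P) d j" and "a2 = second_diff (hx P) a j"
  \<comment> \<open>The stencil of \<open>s_N\<close> meets only columns \<open>j - 1\<close>,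
    \<open>j\<close> and \<open>j + 1\<close>, where \<open>Vt\<close> is the constant
    \<open>V_inf P\<close>.\<close>
  have V_const: "s_N P (\<lambda>j k. of_real (Vt (xnode P j)) * am j k) j k = of_real (V_inf P) * s_N P am j k"
    for k
  proof -
    have "dxx P (\<lambda>j k. of_real (Vt (xnode P j)) * am j k) j k = of_real (V_inf P) * dxx P am j k"
      and "dyy P (\<lambda>j k. of_real (Vt (xnode P j)) * am j k) j k = of_real (V_inf P) * dyy P am j k"
      using Vt by (simp_all add: dxx_def dyy_def fdiff_bdiff second_diff_def
          algebra_simps add_divide_distrib diff_divide_distrib)
    then show ?thesis using Vt by (simp add: s_N_def algebra_simps)
  qed
  have "dst P q (\<lambda>k. \<i> * of_real (hbar P) * s_N P dm j k)
      = dst P q (\<lambda>k. - of_real (c_hbar P) * Delta_hN P am j k + of_real (V_inf P) * s_N P am j k)"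
  proof (rule dst_cong)
    fix k assume k: "1 \<le> k" "k \<le> K_num P - 1"
    then show "\<i> * of_real (hbar P) * s_N P dm j k
        = - of_real (c_hbar P) * Delta_hN P am j k + of_real (V_inf P) * s_N P am j k"
      using kin D[OF k] V_const[of k] unfolding kinetic_step_def am_def dm_def by fastforce
  qed
  then have "\<i> * of_real (hbar P) * dst P q (s_N P dm j)
      = - of_real (c_hbar P) * dst P q (Delta_hN P am j) + of_real (V_inf P) * dst P q (s_N P am j)"
    unfolding dst_linear .
  moreover have "dst P q (s_N P dm j) = of_real \<sigma> * d j + of_real h * d2"
    using dst_s_N[OF assms(1,2) zero(1,2)]
    by (simp add: dst_dm \<sigma>_def h_def d2_def)
  moreover have "dst P q (s_N P am j) = of_real \<sigma> * a j + of_real h * a2"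
    using dst_s_N[OF assms(1,2) zero(3,4)]
    by (simp add: dst_am \<sigma>_def h_def a2_def)
  moreover have "dst P q (Delta_hN P am j)
      = of_real (\<sigma> - h * lam P q) * a2 - of_real (lam P q) * a j"
    using dst_Delta_hN[OF assms(1,2) zero(3,4)]
    by (simp add: dst_am \<sigma>_def h_def a2_def)
  ultimately have core: "\<i> * of_real (hbar P) * (of_real \<sigma> * d j + of_real h * d2)
      = - of_real (c_hbar P) * (of_real (\<sigma> - h * lam P q) * a2 - of_real (lam P q) * a j)
        + of_real (V_inf P) * (of_real \<sigma> * a j + of_real h * a2)"
    by simp
  have hy: "(hy P)\<^sup>2 * lam P q = 12 * (1 - \<sigma>)" by (simp add: \<sigma>_def sig_def)
  have "\<sigma> * V_inf_q P q = \<sigma> * V_inf P + c_hbar P * lam P q"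
    using sig by (simp add: V_inf_q_def \<sigma>_def field_simps)
  then have V: "of_real \<sigma> * of_real (V_inf_q P q)
      = of_real \<sigma> * of_real (V_inf P) + complex_of_real (c_hbar P * lam P q)"
    by (metis of_real_add of_real_mult)
  have "\<sigma> * (theta_q P q * (hx P)\<^sup>2) = h"
    using sig by (simp add: theta_q_def \<sigma>_def h_def)
  then have \<theta>: "of_real \<sigma> * of_real (theta_q P q * (hx P)\<^sup>2) = complex_of_real h"
    by (metis of_real_mult)
  have "\<sigma> * c_hbar_q P q = c_hbar P * (\<sigma> + h * ((hy P)\<^sup>2 * lam P q) * lam P q / (12 * \<sigma>))"
    using sig by (simp add: c_hbar_q_def \<sigma>_def h_def field_simps power2_eq_square)
  also have "\<dots> = c_hbar P * (\<sigma> - h * lam P q) + h * (V_inf_q P q - V_inf P)"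
    unfolding hy using sig by (simp add: V_inf_q_def \<sigma>_def field_simps)
  finally have c: "of_real \<sigma> * of_real (c_hbar_q P q) = of_real (c_hbar P) * of_real (\<sigma> - h * lam P q)
      + complex_of_real h * (of_real (V_inf_q P q) - of_real (V_inf P))"
    by (metis of_real_add of_real_mult of_real_diff)
  have v2: "second_diff (hx P) v j = \<i> * of_real (hbar P) * d2 - of_real (V_inf_q P q) * a2"
    unfolding v_def d2_def a2_def by (rule second_diff_linear)
  have "of_real \<sigma> * (v j + of_real (theta_q P q * (hx P)\<^sup>2) * second_diff (hx P) v j)
      = of_real \<sigma> * (- of_real (c_hbar_q P q) * a2)"
    using core V \<theta> c unfolding v2 unfolding v_def of_real_mult by algebra
  moreover have "complex_of_real \<sigma> \<noteq> 0" using sig by (simp add: \<sigma>_def)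
  ultimately show ?thesis unfolding a2_def using mult_left_cancel by blast
qed

section \<open>Coefficients of the modes and their bounds\<close>

context
  fixes P :: params and q :: nat
  assumes q: "1 \<le> q" "q \<le> K_num P - 1"
begin

text \<open>Here \<open>sig P q\<close> equals \<open>1 - (sin x)^2 / 3\<close>, and the range of
  \<open>q\<close> puts \<open>x\<close> strictly between 0 and \<open>pi / 2\<close>.\<close>

lemma sig_bounds:
  assumes "0 < Y_dom P"
  shows "2 / 3 < sig P q" and "sig P q < 1"
proof -
  define x where "x = pi * real q / (2 * real (K_num P))"
  have K: "0 < K_num P" using q by simp
  have "(hy P)\<^sup>2 * lam P q = 4 * (sin x)\<^sup>2"
    using assms K by (simp add: lam_def hy_def x_def power_mult_distrib power_divide mult_ac)
  then have sig: "sig P q = 1 - (sin x)\<^sup>2 / 3" by (simp add: sig_def)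
  have "0 < x" "x < pi / 2" using q K by (simp_all add: x_def field_simps)
  then have "0 < sin x" "0 < cos x" by (auto intro: sin_gt_zero2 cos_gt_zero)
  then have "0 < (sin x)\<^sup>2" "(sin x)\<^sup>2 < 1" using sin_cos_squared_add[of x]
    by (auto simp del: sin_cos_squared_add intro: zero_less_power)
       (smt (verit) zero_less_power)
  then show "2 / 3 < sig P q" "sig P q < 1" by (simp_all add: sig)
qed

lemma theta_q_bounds:
  assumes "0 < Y_dom P"
  shows "theta_q P q \<in> {1/12<..<1/8}"
  using sig_bounds[OF assms] by (simp add: theta_q_def field_simps)

lemma c_hbar_q_pos:
  assumes "0 < hbar P" and "0 < m0 P"
  shows "0 < c_hbar_q P q"
  using assms unfolding c_hbar_q_def c_hbar_def
  by (intro mult_pos_pos divide_pos_pos add_pos_nonneg) auto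

lemma Im_a_q_pos:
  assumes "0 < hbar P" and "0 < m0 P" and "0 < tau P"
  shows "0 < Im (a_q P q)"
  using assms c_hbar_q_pos by (simp add: a_q_def)

end

text \<open>The cofactor of \<open>a_q\<close> in \<open>alpha_q\<close>. It also lies in the upper
  half plane, so the root of \<open>alpha_q\<close> can be split into two principal roots.\<close>

definition e_q :: "params \<Rightarrow> nat \<Rightarrow> complex" where
  "e_q P q = 2 + of_real ((1 - 4 * theta_q P q) * (hx P)\<^sup>2) * a_q P q"

context
  fixes P :: params and q :: nat
  assumes Im_a: "0 < Im (a_q P q)" and theta: "theta_q P q < 1 / 4" and hx_pos: "0 < hx P"
begin

lemma alpha_q_eq: "alpha_q P q = a_q P q * e_q P q"
  by (simp add: alpha_q_def e_q_def algebra_simps power2_eq_square)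

lemma Im_e_q_pos: "0 < Im (e_q P q)"
  using Im_a theta hx_pos by (simp add: e_q_def)

lemma alpha_q_nonzero: "alpha_q P q \<noteq> 0"
  unfolding alpha_q_eq using Im_a Im_e_q_pos by auto

text \<open>A product of two numbers in the open first quadrant lies in the upper half plane, which
  selects the root with half of \<open>arg_alpha_q\<close>. This links \<open>c1_q\<close> to the
  form of \<open>r\<close> in \<open>branch_condition\<close>.\<close>

lemma sqrt_alpha_q:
  "0 < arg_alpha_q P q"
  "csqrt (a_q P q) * csqrt (e_q P q)
    = of_real (sqrt (cmod (alpha_q P q))) * cis (arg_alpha_q P q / 2)"
proof -
  have "(csqrt (a_q P q) * csqrt (e_q P q))\<^sup>2 = alpha_q P q"
    by (simp add: power_mult_distrib alpha_q_eq)
  moreover have "0 < Im (csqrt (a_q P q) * csqrt (e_q P q))"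
    unfolding times_complex.sel
    by (intro add_pos_pos mult_pos_pos csqrt_first_quadrant Im_a Im_e_q_pos)
  ultimately show "0 < arg_alpha_q P q" "csqrt (a_q P q) * csqrt (e_q P q)
    = of_real (sqrt (cmod (alpha_q P q))) * cis (arg_alpha_q P q / 2)"
    unfolding arg_alpha_q_def by (fact upper_sqrt_eq_Arg2pi)+
qed

lemma c1_q_eq: "c1_q P q = - cnj (csqrt (a_q P q) * csqrt (e_q P q)) / 2"
  unfolding sqrt_alpha_q(2) by (simp add: c1_q_def cis_cnj)

text \<open>The number \<open>cnj (a_q P q) * e_q P q\<close> has real part \<open>beta_q\<close>
  and the modulus of \<open>alpha_q\<close>, and it is not real.\<close>

lemma mu_q_bounds: "mu_q P q \<in> {-1<..<1}"
proof -
  define z where "z = cnj (a_q P q) * e_q P q"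
  have z: "z = 2 * cnj (a_q P q)
      + of_real ((1 - 4 * theta_q P q) * (hx P)\<^sup>2 * (cmod (a_q P q))\<^sup>2)"
    by (simp add: z_def e_q_def algebra_simps complex_norm_square flip: of_real_power)
  have beta: "beta_q P q = Re z" by (simp add: z beta_q_def)
  have "Im z \<noteq> 0" using Im_a by (simp add: z)
  then have "\<bar>Re z\<bar> < cmod z"
    using power2_less_imp_less[of "\<bar>Re z\<bar>" "cmod z"] by (simp add: cmod_power2)
  also have "cmod z = cmod (alpha_q P q)" by (simp add: z_def alpha_q_eq norm_mult)
  finally show ?thesis using alpha_q_nonzero
    by (auto simp: mu_q_def beta field_simps abs_less_iff)
qed

text \<open>In \<open>u m n\<close>, \<open>m\<close> is the time level and \<open>n\<close> the
  column. The equation linking levels \<open>m\<close> and \<open>m + 1\<close> is coefficient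
  \<open>Suc m\<close> of the recurrence for the generating series in time; the constant terms of
  \<open>p\<close> and \<open>g\<close> act on the new level, the linear ones on the old.\<close>

lemma discrete_transparent_boundary:
  fixes u :: "nat \<Rightarrow> nat \<Rightarrow> complex"
  assumes init: "\<And>n. u 0 n = 0"
    and decay: "\<And>m. u m \<longlonglongrightarrow> 0"
  defines "w \<equiv> \<lambda>m n. cnj (a_q P q) * u (Suc m) n + a_q P q * u m n"
    and "A \<equiv> \<lambda>m n. (u (Suc m) n + u m n) / 2"
  assumes eq: "\<And>m n. w m (n + 1) + of_real (theta_q P q * (hx P)\<^sup>2) * second_diff (hx P) (w m) (n + 1)
      = second_diff (hx P) (A m) (n + 1)"
  shows "(A m 1 - A m 0) / of_real (hx P) + of_real (hx P) * s_minus (theta_q P q) (w m) 1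
    = dconv (R_q P q) (\<lambda>m. u m 1) (Suc m)"
proof -
  define a h \<theta> where "a = a_q P q" and "h = complex_of_real (hx P)"
    and "\<theta> = complex_of_real (theta_q P q)"
  have h: "h \<noteq> 0" using hx_pos by (simp add: h_def)
  \<comment> \<open>Here \<open>i\<close> is the reciprocal mesh step, not the imaginary
    unit.\<close>
  define i where "i = 1 / h"
  define p0 p1 g0 g1 where "p0 = i / 2 - \<theta> * h * cnj a" and "p1 = i / 2 - \<theta> * h * a"
    and "g0 = h / 2 * cnj a" and "g1 = h / 2 * a"
  define p g where "p = fps_const p0 + fps_const p1 * fps_X" and "g = fps_const g0 + fps_const g1 * fps_X"
  define R U where "R = Abs_fps (R_q P q)" and "U n = Abs_fps (\<lambda>m. u m n)" for n
  have U_nth: "U n $ m = u m n" for n m by (simp add: U_def)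
  have two_nth: "(2 * f) $ m = 2 * f $ m" for f :: "complex fps" and m
    by (simp add: numeral_fps_const)
  have "p * (U 1 - U 0) + g * U 1 = R * U 1"
  proof (rule fps_transparent_boundary)
    fix n
    have "(p * (U (n + 2) - 2 * U (n + 1) + U n)) $ m = (g * (2 * U (n + 1))) $ m" for m
    proof (cases m)
      case 0
      \<comment> \<open>No equation of the scheme belongs to coefficient 0; it vanishes because
        level 0 does.\<close>
      then show ?thesis
        by (simp add: p_def g_def fps_linear_mult_nth U_nth two_nth init)
    next
      case (Suc l)
      have "w l (n + 1) * h + \<theta> * h * (w l (n + 2) - 2 * w l (n + 1) + w l n)
          = (A l (n + 2) - 2 * A l (n + 1) + A l n) * i"
        using eq[of l n] h
        by (simp add: i_def second_diff_def h_def[symmetric] \<theta>_def[symmetric] field_simps power2_eq_square)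
      then have "p0 * (u (Suc l) (n + 2) - 2 * u (Suc l) (n + 1) + u (Suc l) n)
          + p1 * (u l (n + 2) - 2 * u l (n + 1) + u l n)
          = g0 * (2 * u (Suc l) (n + 1)) + g1 * (2 * u l (n + 1))"
        unfolding p0_def p1_def g0_def g1_def w_def A_def a_def[symmetric]
        by (simp add: algebra_simps add_divide_distrib)
      then show ?thesis
        by (simp add: p_def g_def fps_linear_mult_nth U_nth two_nth Suc)
    qed
    then show "p * (U (n + 2) - 2 * U (n + 1) + U n) = 2 * g * U (n + 1)"
      by (simp add: fps_eq_iff mult_ac)
  next
    have alpha: "alpha_q P q = 2 * a + (1 - 4 * \<theta>) * h\<^sup>2 * a\<^sup>2"
      by (simp add: alpha_q_def a_def \<theta>_def h_def)
    have beta: "complex_of_real (beta_q P q) = a + cnj a + (1 - 4 * \<theta>) * h\<^sup>2 * (a * cnj a)"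
      by (simp add: beta_q_def a_def \<theta>_def h_def complex_add_cnj flip: complex_norm_square)
    have coeff0: "cnj (alpha_q P q) / 4 = 2 * p0 * g0 + g0\<^sup>2"
      using h by (simp add: i_def alpha p0_def g0_def \<theta>_def h_def field_simps power2_eq_square)
    have coeff1: "complex_of_real (beta_q P q / 2) = 2 * (p0 * g1 + p1 * g0 + g0 * g1)"
      unfolding of_real_divide beta using h
      by (simp add: i_def p0_def g0_def p1_def g1_def field_simps power2_eq_square)
    have coeff2: "alpha_q P q / 4 = 2 * p1 * g1 + g1\<^sup>2"
      using h by (simp add: i_def alpha p1_def g1_def field_simps power2_eq_square)
    have "R\<^sup>2 = fps_const (2 * p0 * g0 + g0\<^sup>2)
        + fps_const (2 * (p0 * g1 + p1 * g0 + g0 * g1)) * fps_X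
        + fps_const (2 * p1 * g1 + g1\<^sup>2) * fps_X\<^sup>2"
      unfolding R_def R_q_square[OF alpha_q_nonzero] coeff0 coeff1 coeff2 ..
    then show "R\<^sup>2 = 2 * p * g + g\<^sup>2"
      by (simp add: p_def g_def numeral_fps_const algebra_simps power2_eq_square
          flip: fps_const_add fps_const_mult)
  next
    show "cmod (p $ 0) < cmod (p $ 0 + g $ 0 - R $ 0)"
      using branch_condition[OF Im_a hx_pos theta]
      by (simp add: p_def g_def R_def i_def p0_def g0_def c1_q_eq e_q_def a_def h_def \<theta>_def
          mult_ac)
  next
    show "(\<lambda>n. U n $ m) \<longlonglongrightarrow> 0" for m using decay[of m] by (simp add: U_nth)
  qed
  moreover have dconv_eq: "dconv (R_q P q) (\<lambda>m. u m 1) (Suc m) = (R * U 1) $ Suc m"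
    by (simp only: fps_mult_nth dconv_def R_def U_nth fps_nth_Abs_fps)
  ultimately have "(p * (U 1 - U 0) + g * U 1) $ Suc m = (R * U 1) $ Suc m" by simp
  then have "p0 * (u (Suc m) 1 - u (Suc m) 0) + p1 * (u m 1 - u m 0) + (g0 * u (Suc m) 1 + g1 * u m 1)
      = dconv (R_q P q) (\<lambda>m. u m 1) (Suc m)"
    unfolding dconv_eq by (simp add: p_def g_def fps_linear_mult_nth U_nth)
  moreover have "p0 * (u (Suc m) 1 - u (Suc m) 0) + p1 * (u m 1 - u m 0) + (g0 * u (Suc m) 1 + g1 * u m 1)
      = (A m 1 - A m 0) * i + h * s_minus (theta_q P q) (w m) 1"
    unfolding p0_def p1_def g0_def g1_def w_def A_def s_minus_def a_def[symmetric]
    by (simp add: \<theta>_def[symmetric] algebra_simps add_divide_distrib)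
  ultimately show ?thesis unfolding h_def i_def by simp
qed

end

section \<open>From the scheme on the strip to the boundary condition\<close>

lemma potential_step_zero_potential:
  assumes "potential_step P V Vt D U W" and "(j, k) \<in> D"
    and "V (xnode P j) (ynode P k) = Vt (xnode P j)" and "0 < hbar P" and "0 < tau P"
  shows "W j k = U j k"
  using assms by (auto simp: potential_step_def)

text \<open>Summands of a convergent series tend to zero and dominate every single square in them.
  This supplies the decay that selects the solution.\<close>

lemma H_space_dst_tendsto:
  assumes "W \<in> H_space P"
  shows "(\<lambda>j. dst P q (W j)) \<longlonglongrightarrow> 0"
proof -
  have "(\<lambda>j. W j k) \<longlonglongrightarrow> 0" if k: "k \<in> {1..K_num P - 1}" for k
  proof -
    have lim: "(\<lambda>j. \<Sum>k = 1..K_num P - 1. (cmod (W (Suc j) k))\<^sup>2) \<longlonglongrightarrow> 0"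
      using assms by (intro summable_LIMSEQ_zero) (simp add: H_space_def)
    have le: "(cmod (W (Suc j) k))\<^sup>2 \<le> (\<Sum>k = 1..K_num P - 1. (cmod (W (Suc j) k))\<^sup>2)" for j
      using k by (intro member_le_sum) auto
    have "(\<lambda>j. (cmod (W (Suc j) k))\<^sup>2) \<longlonglongrightarrow> 0"
      by (rule Lim_null_comparison[OF always_eventually lim]) (use le in simp)
    then have "(\<lambda>j. W (Suc j) k) \<longlonglongrightarrow> 0"
      by (simp add: tendsto_norm_zero_iff)
    then show ?thesis by (rule LIMSEQ_imp_Suc)
  qed
  then show ?thesis unfolding dst_def
    by (intro tendsto_mult_right_zero tendsto_null_sum tendsto_mult_left_zero)
qed

text \<open>This explains \<open>a_q\<close>: up to the factor \<open>- c_hbar_q\<close>, the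
  bracket of the boundary condition weights the new level by \<open>cnj a_q\<close> and the old one
  by \<open>a_q\<close>.\<close>

lemma combination_eq_a_q:
  assumes "0 < c_hbar_q P q" and "0 < tau P"
  shows "\<i> * of_real (hbar P) * ((t - b) / of_real (tau P)) - of_real (V_inf_q P q) * ((t + b) / 2)
    = - of_real (c_hbar_q P q) * (cnj (a_q P q) * t + a_q P q * b)"
  using assms by (simp add: a_q_def field_simps)

theorem proposition1:
  fixes P :: params
    and V :: "real \<Rightarrow> real \<Rightarrow> real" and Vt :: "real \<Rightarrow> real"
    and \<Psi>h0 :: mesh_fun
    and F \<Psi>b \<Psi>t \<Psi> :: "nat \<Rightarrow> mesh_fun"
  assumes "0 < hbar P" and "0 < m0 P" and "0 < tau P"
    and "0 < Y_dom P" and "0 < X_pot P" and "X_pot P < X_dom P"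
    and "1 \<le> J_num P" and "1 \<le> K_num P"
    and "hx P \<le> X_dom P - X_pot P"
    and V_const: "\<And>x y. X_pot P \<le> x \<Longrightarrow> 0 < y \<Longrightarrow> y < Y_dom P \<Longrightarrow> V x y = V_inf P"
    and Vt_const: "\<And>x. X_pot P \<le> x \<Longrightarrow> Vt x = V_inf P"
    and \<Psi>h0_H: "\<Psi>h0 \<in> H_space P"
    and F_H: "\<And>m. 1 \<le> m \<Longrightarrow> F m \<in> H_space P"
    and \<Psi>h0_outside: "zero_on \<Psi>h0 (omega_inf P - omega P)"
    and F_outside: "\<And>m. 1 \<le> m \<Longrightarrow> zero_on (F m) (omega_inf P - omega P)"
    and \<Psi>h0_last: "\<And>k. k \<le> K_num P \<Longrightarrow> \<Psi>h0 (J_num P - 1) k = 0"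
    and \<Psi>_H: "\<And>m. \<Psi> m \<in> H_space P"
    and potential_first: "\<And>m. 1 \<le> m \<Longrightarrow> potential_step P V Vt (omega_inf P) (\<Psi> (m - 1)) (\<Psi>b m)"
    and potential_last: "\<And>m. 1 \<le> m \<Longrightarrow> potential_step P V Vt (omega_inf P) (\<Psi>t m) (\<Psi> m)"
    and kinetic: "\<And>m. 1 \<le> m \<Longrightarrow> kinetic_step P Vt (omega_inf P) (F m) (\<Psi>b m) (\<Psi>t m)"
    and boundary: "\<And>m. 1 \<le> m \<Longrightarrow>
      zero_on (\<Psi>b m) (Gamma_inf P) \<and> zero_on (\<Psi>t m) (Gamma_inf P) \<and> zero_on (\<Psi> m) (Gamma_inf P)"
    and initial: "\<forall>(j, k) \<in> cl_omega_inf P. \<Psi> 0 j k = \<Psi>h0 j k"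
  shows "(\<forall>m\<ge>1.
            potential_step P V Vt (omega P \<union> Gamma1 P) (\<Psi> (m - 1)) (\<Psi>b m) \<and>
            potential_step P V Vt (omega P \<union> Gamma1 P) (\<Psi>t m) (\<Psi> m) \<and>
            kinetic_step P Vt (omega P) (F m) (\<Psi>b m) (\<Psi>t m) \<and>
            zero_on (\<Psi>b m) (Gamma_fin P) \<and> zero_on (\<Psi>t m) (Gamma_fin P) \<and>
            zero_on (\<Psi> m) (Gamma_fin P))
       \<and> (\<forall>(j, k) \<in> cl_omega P. \<Psi> 0 j k = \<Psi>h0 j k)
       \<and> (\<forall>m\<ge>1. \<forall>q. 1 \<le> q \<and> q \<le> K_num P - 1 \<longrightarrow> dtbc P \<Psi>b \<Psi>t \<Psi> q m)
       \<and> (\<forall>q. 1 \<le> q \<and> q \<le> K_num P - 1 \<longrightarrow>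
            theta_q P q \<in> {1/12<..<1/8} \<and> alpha_q P q \<noteq> 0 \<and>
            arg_alpha_q P q \<in> {0<..<2 * pi} \<and> mu_q P q \<in> {-1<..<1})"
proof -
  have hx_pos: "0 < hx P" using assms(5-7) by (simp add: hx_def)
  have omega_subset: "omega P \<subseteq> omega_inf P" "omega P \<union> Gamma1 P \<subseteq> omega_inf P"
    using \<open>1 \<le> J_num P\<close> by (auto simp: omega_def omega_inf_def Gamma1_def)
  have Gamma_subset: "Gamma_fin P \<subseteq> Gamma_inf P"
    by (auto simp: Gamma_fin_def Gamma_inf_def bd_omega_def cl_omega_def Gamma1_def
        omega_def omega_inf_def)
  have scheme: "potential_step P V Vt (omega P \<union> Gamma1 P) (\<Psi> (m - 1)) (\<Psi>b m) \<and>
      potential_step P V Vt (omega P \<union> Gamma1 P) (\<Psi>t m) (\<Psi> m) \<and>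
      kinetic_step P Vt (omega P) (F m) (\<Psi>b m) (\<Psi>t m) \<and>
      zero_on (\<Psi>b m) (Gamma_fin P) \<and> zero_on (\<Psi>t m) (Gamma_fin P) \<and>
      zero_on (\<Psi> m) (Gamma_fin P)" if "1 \<le> m" for m
    using potential_first[OF that] potential_last[OF that] kinetic[OF that] boundary[OF that]
      omega_subset Gamma_subset
    unfolding potential_step_def kinetic_step_def zero_on_def by blast
  have start: "\<forall>(j, k) \<in> cl_omega P. \<Psi> 0 j k = \<Psi>h0 j k"
    using initial by (auto simp: cl_omega_def)
  note params = \<open>0 < hbar P\<close> \<open>0 < m0 P\<close> \<open>0 < tau P\<close>
  have mode: "0 < Im (a_q P q)" "theta_q P q < 1 / 4" if "1 \<le> q" "q \<le> K_num P - 1" for q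
    using Im_a_q_pos[OF that params] theta_q_bounds[OF that \<open>0 < Y_dom P\<close>] by simp_all
  have coefficients: "theta_q P q \<in> {1/12<..<1/8} \<and> alpha_q P q \<noteq> 0 \<and>
      arg_alpha_q P q \<in> {0<..<2 * pi} \<and> mu_q P q \<in> {-1<..<1}" if "1 \<le> q" "q \<le> K_num P - 1" for q
    using theta_q_bounds[OF that \<open>0 < Y_dom P\<close>] alpha_q_nonzero[OF mode[OF that] hx_pos]
      sqrt_alpha_q(1)[OF mode[OF that] hx_pos] mu_q_bounds[OF mode[OF that] hx_pos] Arg2pi_lt_2pi
    by (simp add: arg_alpha_q_def)
  obtain L where J: "J_num P = Suc L" using \<open>1 \<le> J_num P\<close> by (cases "J_num P") auto
  have "real (Suc L) * hx P = X_dom P" using J by (simp add: hx_def)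
  \<comment> \<open>Offset \<open>n\<close> stands for column \<open>J - 1 + n\<close>; the bound on
    \<open>hx P\<close> puts already column \<open>J - 1\<close> into the region of constant
    potential.\<close>
  then have far: "X_pot P \<le> xnode P (L + n)" for n
    using \<open>hx P \<le> X_dom P - X_pot P\<close> mult_nonneg_nonneg[OF less_imp_le[OF hx_pos] of_nat_0_le_iff[of n]]
    by (simp add: xnode_def algebra_simps)
  have L_pos: "1 \<le> L" using far[of 0] \<open>0 < X_pot P\<close> by (cases L) (auto simp: xnode_def)
  have no_potential: "V (xnode P (L + n)) (ynode P k) = Vt (xnode P (L + n))"
    if "1 \<le> k" "k \<le> K_num P - 1" for n k
  proof -
    have "0 < ynode P k" "ynode P k < Y_dom P"
      using that \<open>0 < Y_dom P\<close> by (auto simp: ynode_def hy_def field_simps)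
    then show ?thesis using V_const Vt_const far by simp
  qed
  have far_mem: "(L + n, k) \<in> omega_inf P" if "1 \<le> k" "k \<le> K_num P - 1" for n k
    using that L_pos by (simp add: omega_inf_def)
  have outside: "(L + Suc n, k) \<in> omega_inf P - omega P" if "1 \<le> k" "k \<le> K_num P - 1" for n k
    using that J by (simp add: omega_inf_def omega_def)
  have "dtbc P \<Psi>b \<Psi>t \<Psi> q (Suc m)" if q: "1 \<le> q" "q \<le> K_num P - 1" for q m
  proof -
    define u where "u m n = dst P q (\<Psi> m (L + n))" for m n
    \<comment> \<open>Far out the potential steps are identities, so \<open>\<Psi>b\<close> at level
      \<open>Suc m\<close> is \<open>\<Psi>\<close> at level \<open>m\<close> and
      \<open>\<Psi>t\<close> is \<open>\<Psi>\<close> at its own level: a single sequence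
      \<open>u\<close> describes all three.\<close>
    have dst_b: "dst P q (\<Psi>b (Suc m) (L + n)) = u m n" for m n
      unfolding u_def
      using potential_step_zero_potential[OF potential_first[of "Suc m"] far_mem no_potential] params
      by (intro dst_cong) simp
    have dst_t: "dst P q (\<Psi>t (Suc m) (L + n)) = u (Suc m) n" for m n
      unfolding u_def
      using potential_step_zero_potential[OF potential_last[of "Suc m"] far_mem no_potential] params
      by (intro dst_cong) simp
    have init: "u 0 n = 0" for n
    proof -
      have "\<Psi> 0 (L + n) k = 0" if k: "1 \<le> k" "k \<le> K_num P - 1" for k
      proof -
        have "\<Psi> 0 (L + n) k = \<Psi>h0 (L + n) k" using initial k by (auto simp: cl_omega_inf_def)
        also have "\<dots> = 0"
        proof (cases n)
          case 0
          then show ?thesis using \<Psi>h0_last[of k] J k by simp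
        next
          case (Suc l)
          then show ?thesis using \<Psi>h0_outside outside[OF k, of l] unfolding zero_on_def by auto
        qed
        finally show ?thesis .
      qed
      then have "u 0 n = dst P q (\<lambda>k. 0)" unfolding u_def by (intro dst_cong) simp
      then show ?thesis by simp
    qed
    have decay: "u m \<longlonglongrightarrow> 0" for m
    proof -
      have "u m = (\<lambda>n. dst P q (\<Psi> m (n + L)))" by (simp add: fun_eq_iff u_def add.commute)
      then show ?thesis
        using LIMSEQ_ignore_initial_segment[OF H_space_dst_tendsto[OF \<Psi>_H]] by simp
    qed
    define w where "w = (\<lambda>m n. cnj (a_q P q) * u (Suc m) n + a_q P q * u m n)"
    define A where "A = (\<lambda>m n. (u (Suc m) n + u m n) / 2)"
    have c_pos: "0 < c_hbar_q P q" using c_hbar_q_pos[OF q] params by blast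
    note combination = combination_eq_a_q[OF c_pos \<open>0 < tau P\<close>]
    \<comment> \<open>Offset \<open>n + 1\<close> is column \<open>J + n\<close>, outside
      \<open>omega P\<close>, so \<open>F\<close> vanishes there; the left neighbour is at worst
      column \<open>J - 1\<close>.\<close>
    have eq: "w m (n + 1) + of_real (theta_q P q * (hx P)\<^sup>2) * second_diff (hx P) (w m) (n + 1)
        = second_diff (hx P) (A m) (n + 1)" for m n
    proof -
      define v where "v i = \<i> * of_real (hbar P)
          * ((dst P q (\<Psi>t (Suc m) i) - dst P q (\<Psi>b (Suc m) i)) / of_real (tau P))
          - of_real (V_inf_q P q) * ((dst P q (\<Psi>t (Suc m) i) + dst P q (\<Psi>b (Suc m) i)) / 2)" for i
      define a where "a i = (dst P q (\<Psi>t (Suc m) i) + dst P q (\<Psi>b (Suc m) i)) / 2" for i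
      have v: "v (L + n) = - of_real (c_hbar_q P q) * w m n" and a: "a (L + n) = A m n" for n
        unfolding v_def a_def w_def A_def dst_b dst_t by (simp_all only: combination)
      have v2: "second_diff (hx P) v (L + n + 1) = - of_real (c_hbar_q P q) * second_diff (hx P) (w m) (n + 1)"
        using v[of n] v[of "n + 1"] v[of "n + 2"]
        by (simp add: second_diff_def algebra_simps add_divide_distrib diff_divide_distrib)
      have a2: "second_diff (hx P) a (L + n + 1) = second_diff (hx P) (A m) (n + 1)"
        using a[of n] a[of "n + 1"] a[of "n + 2"] by (simp add: second_diff_def)
      have "v (L + n + 1) + of_real (theta_q P q * (hx P)\<^sup>2) * second_diff (hx P) v (L + n + 1)
          = - of_real (c_hbar_q P q) * second_diff (hx P) a (L + n + 1)"
        unfolding v_def a_def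
      proof (rule kinetic_step_mode)
        show "0 < Y_dom P" "1 \<le> K_num P" by fact+
        show "sig P q \<noteq> 0" using sig_bounds[OF q \<open>0 < Y_dom P\<close>] by simp
        show "\<Psi>b (Suc m) i 0 = 0" "\<Psi>b (Suc m) i (K_num P) = 0"
          "\<Psi>t (Suc m) i 0 = 0" "\<Psi>t (Suc m) i (K_num P) = 0" for i
          using boundary[of "Suc m"] q
          by (auto simp: zero_on_def Gamma_inf_def cl_omega_inf_def omega_inf_def)
        show "kinetic_step P Vt (omega_inf P) (F (Suc m)) (\<Psi>b (Suc m)) (\<Psi>t (Suc m))"
          using kinetic by simp
        show "(L + n + 1, k) \<in> omega_inf P \<and> F (Suc m) (L + n + 1) k = 0"
          if k: "1 \<le> k" "k \<le> K_num P - 1" for k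
          using F_outside[of "Suc m"] outside[OF k, of n] unfolding zero_on_def by auto
        show "Vt (xnode P (L + n + 1 - 1)) = V_inf P" "Vt (xnode P (L + n + 1)) = V_inf P"
          "Vt (xnode P (L + n + 1 + 1)) = V_inf P"
          using Vt_const far[of n] far[of "n + 1"] far[of "n + 2"] by (simp_all add: add.assoc)
      qed
      then have "of_real (c_hbar_q P q) * (w m (n + 1)
            + of_real (theta_q P q * (hx P)\<^sup>2) * second_diff (hx P) (w m) (n + 1))
          = of_real (c_hbar_q P q) * second_diff (hx P) (A m) (n + 1)"
        using v[of "n + 1"] unfolding v2 a2 by (simp add: algebra_simps)
      then show ?thesis using c_pos by (metis less_irrefl mult_left_cancel of_real_eq_0_iff)
    qed
    \<comment> \<open>The replaced level 0 is what lets the convolution run over \<open>u\<close>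
      from level 0 on.\<close>
    have "dst P q ((\<Psi>t(0 := \<Psi> 0)) p (J_num P)) = u p 1" for p
      using dst_t[of "p - 1" 1] by (cases p) (simp_all add: u_def J)
    then have conv: "dconv (R_q P q) (\<lambda>p. dst P q ((\<Psi>t(0 := \<Psi> 0)) p (J_num P))) (Suc m)
        = (A m 1 - A m 0) / of_real (hx P) + of_real (hx P) * s_minus (theta_q P q) (w m) 1"
      using discrete_transparent_boundary[OF mode[OF q] hx_pos init decay
          eq[unfolded w_def A_def], of m]
      by (simp add: w_def A_def)
    have nodes: "dst P q (\<Psi>b (Suc m) L) = u m 0" "dst P q (\<Psi>b (Suc m) (Suc L)) = u m 1"
      "dst P q (\<Psi>t (Suc m) L) = u (Suc m) 0" "dst P q (\<Psi>t (Suc m) (Suc L)) = u (Suc m) 1"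
      using dst_b[of m 0] dst_b[of m 1] dst_t[of m 0] dst_t[of m 1] by simp_all
    have far_combination: "\<i> * of_real (hbar P) * ((u (Suc m) n - u m n) / of_real (tau P))
        - of_real (V_inf_q P q) * ((u m n + u (Suc m) n) / 2) = - of_real (c_hbar_q P q) * w m n" for n
      using combination[of "u (Suc m) n" "u m n"] by (simp add: w_def add.commute)
    show ?thesis
      unfolding dtbc_def Let_def conv
      unfolding bdiff_def s_minus_def J diff_Suc_1 nodes far_combination
      by (simp add: A_def algebra_simps)
  qed
  then have "dtbc P \<Psi>b \<Psi>t \<Psi> q m" if "1 \<le> m" "1 \<le> q" "q \<le> K_num P - 1" for m q
    using that by (cases m) auto
  then show ?thesis using scheme start coefficients by blast
qed

end
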